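(* Let $G$ and $H$ be two connected graphs of order $n_1\ge 2$ and $n_2$, respectively. Then $$\dim(G\boxtimes H)\le n_1\cdot \dim(H)+n_2\cdot \dim(G)-\dim(G)\cdot \dim(H).$$
   Context: All graphs are simple and connected; $d_G(x,y)$ denotes the length of a shortest $x$–$y$ path in $G$. A vertex $v$ distinguishes vertices $x,y$ if $d_G(v,x)\ne d_G(v,y)$. A set $S\subseteq V(G)$ is a metric generator for $G$ if every pair of distinct vertices of $G$ is distinguished by some element of $S$; the metric dimension $\dim(G)$ is the minimum cardinality of a metric generator. The strong product $G\boxtimes H$ has vertex set $V(G)\times V(H)$, with $(a,b)$ and $(c,d)$ adjacent iff ($a=c$ and $bd\in E(H)$) or ($b=d$ and $ac\in E(G)$) or ($ac\in E(G)$ and $bd\in E(H)$). *)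

theory Defs
  imports "Graph_Theory.Digraph_Component"
begin

text \<open>
  A finite simple graph is a \<^locale>\<open>pair_graph\<close>: each edge is represented by its two
  opposite arcs, and walks and paths are lists of arcs, so that the length of a path is the
  number of its edges.
\<close>

text \<open>Only meaningful if some path joins the two vertices.\<close>

definition graph_dist :: "'a pair_pre_digraph \<Rightarrow> 'a \<Rightarrow> 'a \<Rightarrow> nat" where
  "graph_dist G x y = (LEAST k. \<exists>p. pre_digraph.apath (with_proj G) x p y \<and> length p = k)"

definition distinguishes :: "'a pair_pre_digraph \<Rightarrow> 'a \<Rightarrow> 'a \<Rightarrow> 'a \<Rightarrow> bool" where
  "distinguishes G v x y \<longleftrightarrow> graph_dist G v x \<noteq> graph_dist G v y"

definition metric_generator :: "'a pair_pre_digraph \<Rightarrow> 'a set \<Rightarrow> bool" where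
  "metric_generator G S \<longleftrightarrow>
     S \<subseteq> pverts G \<and>
     (\<forall>x\<in>pverts G. \<forall>y\<in>pverts G. x \<noteq> y \<longrightarrow> (\<exists>v\<in>S. distinguishes G v x y))"

definition metric_dim :: "'a pair_pre_digraph \<Rightarrow> nat" where
  "metric_dim G = (LEAST k. \<exists>S. metric_generator G S \<and> card S = k)"

definition strong_product ::
    "'a pair_pre_digraph \<Rightarrow> 'b pair_pre_digraph \<Rightarrow> ('a \<times> 'b) pair_pre_digraph" where
  "strong_product G H =
     \<lparr> pverts = pverts G \<times> pverts H,
       parcs = {((a, b), (c, d)) | a b c d.
         (a, b) \<in> pverts G \<times> pverts H \<and> (c, d) \<in> pverts G \<times> pverts H \<and>
         ((a = c \<and> (b, d) \<in> parcs H) \<or>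
          (b = d \<and> (a, c) \<in> parcs G) \<or>
          ((a, c) \<in> parcs G \<and> (b, d) \<in> parcs H))} \<rparr>"

lemma pair_graph_strong_product:
  assumes "pair_graph G" and "pair_graph H"
  shows "pair_graph (strong_product G H)"
proof -
  interpret G: pair_graph G by fact
  interpret H: pair_graph H by fact
  let ?P = "strong_product G H"
  have sub: "parcs ?P \<subseteq> (pverts G \<times> pverts H) \<times> (pverts G \<times> pverts H)"
    by (auto simp: strong_product_def)
  have symG: "(c, a) \<in> parcs G" if "(a, c) \<in> parcs G" for a c
    using G.pair_sym_arcs that by (auto simp: symmetric_def dest: symD)
  have symH: "(c, a) \<in> parcs H" if "(a, c) \<in> parcs H" for a c
    using H.pair_sym_arcs that by (auto simp: symmetric_def dest: symD)
  show ?thesis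
  proof unfold_locales
    show "fst e \<in> pverts ?P" "snd e \<in> pverts ?P" if "e \<in> parcs ?P" for e
      using that sub by (auto simp: strong_product_def)
    show "finite (pverts ?P)"
      by (simp add: strong_product_def G.pair_finite_verts H.pair_finite_verts)
    show "finite (parcs ?P)"
      using sub by (rule finite_subset) (simp add: G.pair_finite_verts H.pair_finite_verts)
    show "fst e \<noteq> snd e" if "e \<in> parcs ?P" for e
      using that G.pair_no_loops H.pair_no_loops by (fastforce simp: strong_product_def)
    show "symmetric ?P"
      unfolding symmetric_def by (rule symI) (auto simp: strong_product_def symG symH)
  qed
qed

end

theory Submission
  imports Defs
begin

text \<open>
  If \<open>A\<close> and \<open>B\<close> are metric bases of \<open>G\<close> and \<open>H\<close>, then
  \<open>(V(G) \<times> B) \<union> (A \<times> V(H))\<close> is a metric generator of the strong product. Given \<open>(a, b)\<close> and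
  \<open>(c, d)\<close> with \<open>b \<noteq> d\<close>, pick \<open>s \<in> B\<close> with, say, \<open>d(s, b) < d(s, d)\<close>. Inside a fibre the
  distance of the product is that of the factor, and projecting to a factor does not increase
  distances, so \<open>(a, s)\<close> has distance \<open>d(s, b)\<close> from \<open>(a, b)\<close> and at least \<open>d(s, d)\<close> from
  \<open>(c, d)\<close>. If \<open>b = d\<close>, a vertex of \<open>A\<close> distinguishing \<open>a\<close> and \<open>c\<close> does the same.
\<close>

section \<open>Distances as lengths of shortest walks\<close>

text \<open>Cutting closed subwalks out of a walk only shortens it. This allows
  \<open>graph_dist\<close>, a minimum over paths, to be bounded by walks, which are all that a map
  of graphs produces.\<close>

lemma (in wf_digraph) apath_shorter_than_awalk:
  assumes "awalk u p v"
  shows "\<exists>q. apath u q v \<and> length q \<le> length p"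
  using assms
proof (induct rule: awalk_to_apath_induct)
  case (path p)
  then show ?case by (auto simp: apath_def)
next
  case (decomp p q r s)
  have "p = q @ r @ s"
    using awalk_cyc_decompE[OF decomp(2,1,3)] by metis
  moreover obtain q' where "apath u q' v" "length q' \<le> length (q @ s)"
    using decomp(4) by blast
  ultimately show ?case
    by (intro exI[of _ q']) simp
qed

context pair_wf_digraph
begin

lemma graph_dist_le_length_awalk:
  assumes "awalk x p y"
  shows "graph_dist G x y \<le> length p"
proof -
  obtain q where q: "apath x q y" "length q \<le> length p"
    using apath_shorter_than_awalk[OF assms] by blast
  then have "graph_dist G x y \<le> length q"
    unfolding graph_dist_def by (intro Least_le) blast
  with q show ?thesis by simp
qed

text \<open>Reachability makes the set under \<open>LEAST\<close> nonempty, so its minimum is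
  attained.\<close>

lemma awalk_length_graph_dist:
  assumes "reachable (with_proj G) x y"
  shows "\<exists>p. awalk x p y \<and> length p = graph_dist G x y"
proof -
  obtain p where "awalk x p y"
    using assms reachable_awalk by blast
  then obtain q where "apath x q y"
    using apath_shorter_than_awalk by blast
  then have "\<exists>k q. apath x q y \<and> length q = k"
    by blast
  then have "\<exists>p. apath x p y \<and> length p = graph_dist G x y"
    unfolding graph_dist_def by (rule LeastI_ex)
  then show ?thesis
    by (auto simp: apath_def)
qed

end

section \<open>Weak homomorphisms: projections and fibres\<close>

text \<open>Arcs may collapse to a vertex, as a projection of the strong product collapses every arc
  that moves only the other coordinate.\<close>

definition weak_hom :: "'a pair_pre_digraph \<Rightarrow> 'b pair_pre_digraph \<Rightarrow> ('a \<Rightarrow> 'b) \<Rightarrow> bool" where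
  "weak_hom P Q f \<longleftrightarrow> (\<forall>x\<in>pverts P. f x \<in> pverts Q) \<and>
     (\<forall>(x, y)\<in>parcs P. f x = f y \<or> (f x, f y) \<in> parcs Q)"

text \<open>The walk is mapped arc by arc and collapsed arcs are dropped.\<close>

lemma weak_hom_awalk:
  assumes P: "pair_wf_digraph P" and Q: "pair_wf_digraph Q" and f: "weak_hom P Q f"
    and "pre_digraph.awalk (with_proj P) x p y"
  shows "\<exists>q. pre_digraph.awalk (with_proj Q) (f x) q (f y) \<and> length q \<le> length p"
proof -
  interpret P: pair_wf_digraph P by fact
  interpret Q: pair_wf_digraph Q by fact
  from assms(4) show ?thesis
  proof (induct p arbitrary: x)
    case Nil
    then have "Q.awalk (f x) [] (f y)"
      using f by (auto simp: P.awalk_Nil_iff Q.awalk_Nil_iff weak_hom_def)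
    then show ?case
      by (intro exI[of _ "[]"]) simp
  next
    case (Cons e p)
    then have e: "e \<in> parcs P" "fst e = x" and "P.awalk (snd e) p y"
      by (auto simp: P.awalk_Cons_iff)
    with Cons obtain q where q: "Q.awalk (f (snd e)) q (f y)" "length q \<le> length p"
      by blast
    consider "f x = f (snd e)" | "(f x, f (snd e)) \<in> parcs Q"
      using e f by (cases e) (auto simp: weak_hom_def)
    then show ?case
    proof cases
      case 1
      with q show ?thesis by (intro exI[of _ q]) simp
    next
      case 2
      with q have "Q.awalk (f x) ((f x, f (snd e)) # q) (f y)"
        by (simp add: Q.awalk_Cons_iff)
      with q show ?thesis
        by (intro exI[of _ "(f x, f (snd e)) # q"]) simp
    qed
  qed
qed

lemma weak_hom_reachable:
  assumes "pair_wf_digraph P" "pair_wf_digraph Q" "weak_hom P Q f"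
    and "reachable (with_proj P) x y"
  shows "reachable (with_proj Q) (f x) (f y)"
proof -
  interpret P: pair_wf_digraph P by fact
  interpret Q: pair_wf_digraph Q by fact
  obtain p where "P.awalk x p y"
    using assms(4) P.reachable_awalk by blast
  then obtain q where "Q.awalk (f x) q (f y)"
    using weak_hom_awalk[OF assms(1-3)] by blast
  then show ?thesis
    by (rule Q.reachable_awalkI)
qed

lemma graph_dist_weak_hom_le:
  assumes "pair_wf_digraph P" "pair_wf_digraph Q" "weak_hom P Q f"
    and "reachable (with_proj P) x y"
  shows "graph_dist Q (f x) (f y) \<le> graph_dist P x y"
proof -
  interpret P: pair_wf_digraph P by fact
  interpret Q: pair_wf_digraph Q by fact
  obtain p where p: "P.awalk x p y" "length p = graph_dist P x y"
    using P.awalk_length_graph_dist[OF assms(4)] by blast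
  then obtain q where "Q.awalk (f x) q (f y)" "length q \<le> graph_dist P x y"
    using weak_hom_awalk[OF assms(1-3)] by metis
  then show ?thesis
    using Q.graph_dist_le_length_awalk order_trans by blast
qed

lemma weak_hom_fst: "weak_hom (strong_product G H) G fst"
  and weak_hom_snd: "weak_hom (strong_product G H) H snd"
  by (auto simp: weak_hom_def strong_product_def)

text \<open>Together with \<open>weak_hom_fst\<close> this bounds distances from both sides, so that
  the fibre over \<open>b\<close> is an isometric copy of \<open>G\<close> when \<open>G\<close> and
  \<open>H\<close> are connected.\<close>

lemma weak_hom_fibre_fst:
  assumes "pair_wf_digraph G" "b \<in> pverts H"
  shows "weak_hom G (strong_product G H) (\<lambda>x. (x, b))"
  using assms pair_wf_digraph.arc_fst_in_verts[OF assms(1)]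
    pair_wf_digraph.arc_snd_in_verts[OF assms(1)]
  by (fastforce simp: weak_hom_def strong_product_def)

lemma weak_hom_fibre_snd:
  assumes "pair_wf_digraph H" "a \<in> pverts G"
  shows "weak_hom H (strong_product G H) (\<lambda>y. (a, y))"
  using assms pair_wf_digraph.arc_fst_in_verts[OF assms(1)]
    pair_wf_digraph.arc_snd_in_verts[OF assms(1)]
  by (fastforce simp: weak_hom_def strong_product_def)

section \<open>Connectivity and metric bases\<close>

text \<open>The library defines \<open>connected\<close> through the symmetric closure; the arcs are
  already symmetric, so strong connectivity follows.\<close>

lemma connected_pair_graph_reachable:
  assumes "pair_graph G" "Digraph_Component.connected (with_proj G)"
    and "x \<in> pverts G" "y \<in> pverts G"
  shows "reachable (with_proj G) x y"
proof -
  interpret G: pair_graph G by fact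
  have "strongly_connected (with_proj G)"
    using G.symmetric_connected_imp_strongly_connected G.pair_sym_arcs assms(2) by blast
  then show ?thesis
    using assms(3,4) by auto
qed

lemma finite_metric_generator:
  assumes "pair_graph G" "metric_generator G S"
  shows "finite S"
proof -
  interpret G: pair_graph G by fact
  show ?thesis
    using assms(2) G.pair_finite_verts by (auto simp: metric_generator_def intro: finite_subset)
qed

lemma metric_dim_le:
  "metric_generator G S \<Longrightarrow> metric_dim G \<le> card S"
  unfolding metric_dim_def by (intro Least_le) blast

lemma graph_dist_self:
  assumes "pair_wf_digraph G" "x \<in> pverts G"
  shows "graph_dist G x x = 0"
proof -
  interpret G: pair_wf_digraph G by fact
  have "G.awalk x [] x"
    using assms(2) by (simp add: G.awalk_Nil_iff)
  from G.graph_dist_le_length_awalk[OF this] show ?thesis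
    by simp
qed

lemma graph_dist_eq_0:
  assumes "pair_wf_digraph G" "reachable (with_proj G) x y" "graph_dist G x y = 0"
  shows "x = y"
proof -
  interpret G: pair_wf_digraph G by fact
  obtain p where "G.awalk x p y" "length p = 0"
    using G.awalk_length_graph_dist[OF assms(2)] assms(3) by auto
  then show ?thesis
    by (simp add: G.awalk_Nil_iff)
qed

text \<open>All vertices together form a metric generator, since \<open>x\<close> has distance 0
  only to itself. Hence the minimum in \<open>metric_dim\<close> is attained.\<close>

lemma metric_basis_exists:
  assumes "pair_graph G" "Digraph_Component.connected (with_proj G)"
  obtains S where "metric_generator G S" "card S = metric_dim G"
proof -
  interpret G: pair_graph G by fact
  have "distinguishes G x x y" if "x \<in> pverts G" "y \<in> pverts G" "x \<noteq> y" for x y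
    using that graph_dist_self[OF G.pair_wf_digraph_axioms that(1)]
      graph_dist_eq_0[OF G.pair_wf_digraph_axioms connected_pair_graph_reachable[OF assms that(1,2)]]
    unfolding distinguishes_def by metis
  then have "metric_generator G (pverts G)"
    by (auto simp: metric_generator_def)
  then have "\<exists>k S. metric_generator G S \<and> card S = k"
    by blast
  then have "\<exists>S. metric_generator G S \<and> card S = metric_dim G"
    unfolding metric_dim_def by (rule LeastI_ex)
  with that show thesis by blast
qed

section \<open>The metric generator of the strong product\<close>

text \<open>One coordinate is changed at a time, through \<open>(c, b)\<close>, each time inside a
  fibre.\<close>

lemma strong_product_reachable:
  assumes "pair_graph G" "Digraph_Component.connected (with_proj G)"
    and "pair_graph H" "Digraph_Component.connected (with_proj H)"
    and "a \<in> pverts G" "b \<in> pverts H" "c \<in> pverts G" "d \<in> pverts H"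
  shows "reachable (with_proj (strong_product G H)) (a, b) (c, d)"
proof -
  interpret G: pair_graph G by fact
  interpret H: pair_graph H by fact
  interpret P: pair_graph "strong_product G H"
    using assms by (intro pair_graph_strong_product)
  note wf = G.pair_wf_digraph_axioms H.pair_wf_digraph_axioms P.pair_wf_digraph_axioms
  have "reachable (with_proj (strong_product G H)) (a, b) (c, b)"
    by (rule weak_hom_reachable[OF wf(1,3) weak_hom_fibre_fst[OF wf(1) \<open>b \<in> pverts H\<close>]
          connected_pair_graph_reachable[OF assms(1,2,5,7)]])
  moreover have "reachable (with_proj (strong_product G H)) (c, b) (c, d)"
    by (rule weak_hom_reachable[OF wf(2,3) weak_hom_fibre_snd[OF wf(2) \<open>c \<in> pverts G\<close>]
          connected_pair_graph_reachable[OF assms(3,4,6,8)]])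
  ultimately show ?thesis
    by (rule P.reachable_trans)
qed

lemma metric_generator_strong_product:
  assumes G: "pair_graph G" "Digraph_Component.connected (with_proj G)"
    and H: "pair_graph H" "Digraph_Component.connected (with_proj H)"
    and A: "metric_generator G A" and B: "metric_generator H B"
  shows "metric_generator (strong_product G H) (pverts G \<times> B \<union> A \<times> pverts H)"
proof -
  let ?P = "strong_product G H"
  interpret G: pair_graph G by fact
  interpret H: pair_graph H by fact
  interpret P: pair_graph ?P
    using assms by (intro pair_graph_strong_product)
  note wf = G.pair_wf_digraph_axioms H.pair_wf_digraph_axioms P.pair_wf_digraph_axioms
  have AB: "A \<subseteq> pverts G" "B \<subseteq> pverts H"
    using A B by (auto simp: metric_generator_def)
  have fst_le: "graph_dist G a c \<le> graph_dist ?P (a, b) (c, d)"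
    and snd_le: "graph_dist H b d \<le> graph_dist ?P (a, b) (c, d)"
    if "a \<in> pverts G" "b \<in> pverts H" "c \<in> pverts G" "d \<in> pverts H" for a b c d
    using graph_dist_weak_hom_le[OF wf(3,1) weak_hom_fst strong_product_reachable[OF G H that]]
      graph_dist_weak_hom_le[OF wf(3,2) weak_hom_snd strong_product_reachable[OF G H that]]
    by simp_all
  have fibre_fst: "graph_dist ?P (a, b) (c, b) \<le> graph_dist G a c"
    if "a \<in> pverts G" "b \<in> pverts H" "c \<in> pverts G" for a b c
    using that by (intro graph_dist_weak_hom_le[OF wf(1,3) weak_hom_fibre_fst[OF wf(1)]]
        connected_pair_graph_reachable[OF G])
  have fibre_snd: "graph_dist ?P (a, b) (a, d) \<le> graph_dist H b d"
    if "a \<in> pverts G" "b \<in> pverts H" "d \<in> pverts H" for a b d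
    using that by (intro graph_dist_weak_hom_le[OF wf(2,3) weak_hom_fibre_snd[OF wf(2)]]
        connected_pair_graph_reachable[OF H])
  have ex: "\<exists>v \<in> pverts G \<times> B \<union> A \<times> pverts H. distinguishes ?P v (a, b) (c, d)"
    if verts: "a \<in> pverts G" "b \<in> pverts H" "c \<in> pverts G" "d \<in> pverts H"
      and ne: "(a, b) \<noteq> (c, d)" for a b c d
  proof (cases "b = d")
    case False
    then obtain s where s: "s \<in> B" "graph_dist H s b \<noteq> graph_dist H s d"
      using B verts unfolding metric_generator_def distinguishes_def by blast
    then have sH: "s \<in> pverts H" using AB by auto
    show ?thesis
    proof (cases "graph_dist H s b < graph_dist H s d")
      case True
      \<comment> \<open>The distance to \<open>(a, b)\<close> is at most d(s, b) within the fibre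
        over \<open>a\<close>, and the distance to \<open>(c, d)\<close> is at least d(s, d) by
        projection.\<close>
      then have "distinguishes ?P (a, s) (a, b) (c, d)"
        using fibre_snd[of a s b] snd_le[of a s c d] verts sH
        by (simp add: distinguishes_def)
      with s verts show ?thesis by blast
    next
      case False
      \<comment> \<open>Now \<open>s\<close> is closer to \<open>d\<close>, so the witness moves to
        the fibre of \<open>(c, d)\<close>.\<close>
      then have "distinguishes ?P (c, s) (a, b) (c, d)"
        using fibre_snd[of c s d] snd_le[of c s a b] verts sH s(2)
        by (simp add: distinguishes_def)
      with s verts show ?thesis by blast
    qed
  next
    case True
    with ne have "a \<noteq> c" by simp
    then obtain s where s: "s \<in> A" "graph_dist G s a \<noteq> graph_dist G s c"
      using A verts unfolding metric_generator_def distinguishes_def by blast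
    then have sG: "s \<in> pverts G" using AB by auto
    \<comment> \<open>All three vertices lie in the fibre over \<open>b\<close>, where both bounds
      together give equality with distances in \<open>G\<close>; no case split on which is smaller
      arises.\<close>
    have "distinguishes ?P (s, b) (a, b) (c, d)"
      using fibre_fst[of s b a] fst_le[of s b a b] fibre_fst[of s b c] fst_le[of s b c b]
        verts sG s(2) True
      by (simp add: distinguishes_def)
    with s verts show ?thesis by blast
  qed
  have "pverts ?P = pverts G \<times> pverts H"
    by (simp add: strong_product_def)
  then show ?thesis
    using AB ex unfolding metric_generator_def by auto
qed

theorem theorem1:
  fixes G :: "'a pair_pre_digraph" and H :: "'b pair_pre_digraph" and n1 n2 :: nat
  assumes "pair_graph G" and "Digraph_Component.connected (with_proj G)"
    and "pair_graph H" and "Digraph_Component.connected (with_proj H)"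
    and "card (pverts G) = n1" and "n1 \<ge> 2"
    and "card (pverts H) = n2"
  shows "int (metric_dim (strong_product G H)) \<le>
    int n1 * int (metric_dim H) + int n2 * int (metric_dim G) - int (metric_dim G) * int (metric_dim H)"
proof -
  interpret G: pair_graph G by fact
  interpret H: pair_graph H by fact
  obtain A where A: "metric_generator G A" "card A = metric_dim G"
    using metric_basis_exists assms(1,2) by blast
  obtain B where B: "metric_generator H B" "card B = metric_dim H"
    using metric_basis_exists assms(3,4) by blast
  let ?X = "pverts G \<times> B" and ?Y = "A \<times> pverts H"
  have "finite ?X" "finite ?Y"
    using A B assms finite_metric_generator G.pair_finite_verts H.pair_finite_verts by blast+
  then have "card ?X + card ?Y = card (?X \<union> ?Y) + card (?X \<inter> ?Y)"
    by (rule card_Un_Int)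
  \<comment> \<open>This overlap is counted twice and yields the subtracted product.\<close>
  moreover have "?X \<inter> ?Y = A \<times> B"
    using A B by (auto simp: metric_generator_def)
  ultimately have "n1 * metric_dim H + metric_dim G * n2 =
      card (?X \<union> ?Y) + metric_dim G * metric_dim H"
    using A B assms by (simp add: card_cartesian_product)
  moreover have "metric_dim (strong_product G H) \<le> card (?X \<union> ?Y)"
    using assms A B by (intro metric_dim_le metric_generator_strong_product)
  \<comment> \<open>The product stays on the left to avoid truncated subtraction on
    \<open>nat\<close>; it is moved across only after the cast to \<open>int\<close>.\<close>
  ultimately have "metric_dim (strong_product G H) + metric_dim G * metric_dim H
      \<le> n1 * metric_dim H + n2 * metric_dim G"
    by (simp add: mult.commute)
  then have "int (metric_dim (strong_product G H) + metric_dim G * metric_dim H)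
      \<le> int (n1 * metric_dim H + n2 * metric_dim G)"
    by (rule zle_int[THEN iffD2])
  then show ?thesis
    by simp
qed

end
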